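(* There exists a bijection $$\theta_2:\bigsqcup_{i\ge0}(\mathscr{A}^{\mathrm{V}}_i\times\mathscr{B}^{\mathrm{V}}_i)\to\mathscr{D}^{\mathrm{e}}\times\mathscr{D},\qquad(\lambda,\mu)\mapsto(\beta,\gamma),$$ such that $|\lambda|+|\mu|=|\beta|+|\gamma|$.
   Context: Partitions are finite weakly increasing lists of positive integers; $|\lambda|$ is the sum of parts. For $i\ge0$, $\mathscr{A}^{\mathrm{V}}_i$ is the set of partitions $\lambda$ with either $2i$ or $2i-1$ parts in which any two adjacent parts differ by at least $2$, and such that if the number of parts is $2i-1$ then the smallest part is greater than $1$. $\mathscr{B}^{\mathrm{V}}_i$ is the set of partitions into distinct parts whose smallest part is at least $2i+1$. $\mathscr{D}^{\mathrm{e}}$ is the set of partitions into distinct even parts and $\mathscr{D}$ is the set of partitions into distinct parts. *)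

theory Defs
  imports Main
begin

definition partitions :: "nat list set" where
  "partitions = {l. sorted l \<and> (\<forall>x\<in>set l. 0 < x)}"

(* The number of parts being 2i - 1 is written as length l + 1 = 2 * i: truncated subtraction
   would identify 2i - 1 and 2i for i = 0. The side condition on the smallest part then only
   concerns nonempty lists, so it can be stated for all parts. *)
definition A_V :: "nat \<Rightarrow> nat list set" where
  "A_V i = {l \<in> partitions.
     (length l = 2 * i \<or> length l + 1 = 2 * i) \<and>
     successively (\<lambda>x y. x + 2 \<le> y) l \<and>
     (length l + 1 = 2 * i \<longrightarrow> (\<forall>x\<in>set l. 1 < x))}"

definition D_all :: "nat list set" where
  "D_all = {l \<in> partitions. distinct l}"

(* The empty partition belongs to B_V i for every i. *)
definition B_V :: "nat \<Rightarrow> nat list set" where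
  "B_V i = {l \<in> D_all. \<forall>x\<in>set l. 2 * i + 1 \<le> x}"

definition D_even :: "nat list set" where
  "D_even = {l \<in> D_all. \<forall>x\<in>set l. even x}"

end

theory Submission
  imports Defs
begin

text \<open>
  Pad the members of \<open>A_V i\<close> with a zero part to get exactly \<open>k = 2 * i\<close> nonnegative parts
  with gaps at least \<open>2\<close>, and similarly pad the partitions into distinct even parts. Round each
  difference between consecutive parts (the first part included) down to an even number. Lowering
  the difference at the \<open>j\<close>-th part, counted from \<open>0\<close>, by one lowers \<open>k - j\<close> parts; so the odd
  differences are recorded by distinct parts of size at most \<open>k\<close>, which together with a member of
  \<open>B_V i\<close> form an arbitrary partition into distinct parts.
\<close>

text \<open>Only the existence of the map is recorded, so the bijection of the theorem is assembled
  through transitivity, disjoint unions and products, and the composite is never written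
  out.\<close>

definition weight_equiv :: "'a set \<Rightarrow> ('a \<Rightarrow> nat) \<Rightarrow> 'b set \<Rightarrow> ('b \<Rightarrow> nat) \<Rightarrow> bool" where
  "weight_equiv A w B v \<longleftrightarrow> (\<exists>f. bij_betw f A B \<and> (\<forall>x\<in>A. v (f x) = w x))"

lemma weight_equivI:
  assumes "\<And>x. x \<in> A \<Longrightarrow> f x \<in> B" "\<And>y. y \<in> B \<Longrightarrow> g y \<in> A"
    and "\<And>x. x \<in> A \<Longrightarrow> g (f x) = x" "\<And>y. y \<in> B \<Longrightarrow> f (g y) = y"
    and "\<And>x. x \<in> A \<Longrightarrow> v (f x) = w x"
  shows "weight_equiv A w B v"
  unfolding weight_equiv_def
  by (rule exI[of _ f], intro conjI bij_betw_byWitness[of A g f B]) (use assms in auto)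

lemma weight_equiv_refl: "weight_equiv A w A w"
  by (rule weight_equivI[of _ id _ id]) auto

lemma weight_equiv_sym:
  assumes "weight_equiv A w B v"
  shows "weight_equiv B v A w"
proof -
  obtain f where f: "bij_betw f A B" "\<forall>x\<in>A. v (f x) = w x"
    using assms by (auto simp: weight_equiv_def)
  have "w (inv_into A f y) = v y" if "y \<in> B" for y
    using f that by (metis bij_betw_inv_into_right bij_betwE bij_betw_inv_into)
  then show ?thesis
    using bij_betw_inv_into[OF f(1)] by (auto simp: weight_equiv_def)
qed

lemma weight_equiv_trans [trans]:
  assumes "weight_equiv A w B v" "weight_equiv B v C u"
  shows "weight_equiv A w C u"
proof -
  obtain f g where "bij_betw f A B" "\<forall>x\<in>A. v (f x) = w x"
    "bij_betw g B C" "\<forall>x\<in>B. u (g x) = v x"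
    using assms by (auto simp: weight_equiv_def)
  then show ?thesis
    unfolding weight_equiv_def
    by (intro exI[of _ "g \<circ> f"]) (auto intro: bij_betw_trans dest: bij_betwE)
qed

lemma weight_equiv_Sigma:
  assumes "\<And>i. i \<in> I \<Longrightarrow> weight_equiv (A i) (w i) (B i) (v i)"
  shows "weight_equiv (SIGMA i:I. A i) (\<lambda>(i, x). w i x) (SIGMA i:I. B i) (\<lambda>(i, x). v i x)"
proof -
  obtain f where f: "\<And>i. i \<in> I \<Longrightarrow> bij_betw (f i) (A i) (B i)"
      "\<And>i x. i \<in> I \<Longrightarrow> x \<in> A i \<Longrightarrow> v i (f i x) = w i x"
    using assms unfolding weight_equiv_def by metis
  have g: "inv_into (A i) (f i) y \<in> A i" "f i (inv_into (A i) (f i) y) = y"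
    if "i \<in> I" "y \<in> B i" for i y
    using f(1)[OF that(1)] that(2)
    by (auto intro: bij_betw_inv_into_right simp: bij_betw_def inv_into_into)
  show ?thesis
    by (rule weight_equivI[of _ "\<lambda>(i, x). (i, f i x)" _ "\<lambda>(i, y). (i, inv_into (A i) (f i) y)"])
      (use f g in \<open>auto intro: bij_betw_inv_into_left dest: bij_betwE\<close>)
qed

lemma weight_equiv_Times:
  assumes "weight_equiv A w B v" "weight_equiv C t D u"
  shows "weight_equiv (A \<times> C) (\<lambda>(x, y). w x + t y) (B \<times> D) (\<lambda>(x, y). v x + u y)"
proof -
  obtain f g where "bij_betw f A B" "\<forall>x\<in>A. v (f x) = w x"
    "bij_betw g C D" "\<forall>x\<in>C. u (g x) = t x"
    using assms by (auto simp: weight_equiv_def)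
  then show ?thesis
    unfolding weight_equiv_def
    by (intro exI[of _ "map_prod f g"]) (auto intro: bij_betw_map_prod)
qed

text \<open>The predicate \<open>R\<close> is constantly true before the rounding and
  \<open>even\<close> after it, so both sides share the padding and the recursion.\<close>

definition gap2_lists :: "nat \<Rightarrow> (nat \<Rightarrow> bool) \<Rightarrow> nat list set" where
  "gap2_lists k R = {l. length l = k \<and> sorted_wrt (\<lambda>x y. x + 2 \<le> y) l \<and> (\<forall>x\<in>set l. R x)}"

definition bounded_distinct :: "nat \<Rightarrow> nat list set" where
  "bounded_distinct k = {l \<in> D_all. \<forall>x\<in>set l. x \<le> k}"

lemma D_all_iff: "l \<in> D_all \<longleftrightarrow> sorted_wrt (<) l \<and> (\<forall>x\<in>set l. 0 < x)"
  by (auto simp: D_all_def partitions_def strict_sorted_iff)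

text \<open>The gap relation is transitive and implies \<le>, so gaps between adjacent parts give
  gaps between all pairs, and sortedness comes with them.\<close>

lemma A_V_iff:
  "l \<in> A_V i \<longleftrightarrow> (\<forall>x\<in>set l. 0 < x) \<and> sorted_wrt (\<lambda>x y. x + 2 \<le> y) l \<and>
     (length l = 2 * i \<or> length l + 1 = 2 * i) \<and> (length l + 1 = 2 * i \<longrightarrow> (\<forall>x\<in>set l. 1 < x))"
proof -
  have "successively (\<lambda>x y. x + 2 \<le> y) l \<longleftrightarrow> sorted_wrt (\<lambda>x y. x + 2 \<le> y) l"
    by (rule successively_conv_sorted_wrt) (auto simp: transp_def)
  moreover have "sorted l" if "sorted_wrt (\<lambda>x y. x + 2 \<le> y) l"
    using that by (rule sorted_wrt_mono_rel[rotated]) simp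
  ultimately show ?thesis
    by (auto simp only: A_V_def partitions_def mem_Collect_eq)
qed

text \<open>A zero can only be the first entry, and the gap then forces every other entry above
  \<open>1\<close>. This is exactly the condition on lists with one part fewer, so deleting and
  restoring the zero are mutually inverse. \<open>R 0\<close> keeps the padded list
  admissible.\<close>

lemma gap2_lists_weight_equiv_A_V:
  assumes "R 0"
  shows "weight_equiv (gap2_lists (2 * i) R) sum_list {l \<in> A_V i. \<forall>x\<in>set l. R x} sum_list"
proof (rule weight_equivI[of _ "filter ((<) 0)" _ "\<lambda>l. replicate (2 * i - length l) 0 @ l"])
  fix l assume l: "l \<in> gap2_lists (2 * i) R"
  consider "\<forall>x\<in>set l. 0 < x" | m where "l = 0 # m" "\<forall>x\<in>set m. 1 < x"
    using l by (cases l) (fastforce simp: gap2_lists_def)+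
  note * = this
  have pos: "filter ((<) 0) l = l" if "\<forall>x\<in>set l. 0 < x" for l :: "nat list"
    using that by (simp add: filter_id_conv)
  have pos1: "filter ((<) 0) l = l" if "\<forall>x\<in>set l. 1 < x" for l :: "nat list"
    using that by (intro pos) auto
  show "filter ((<) 0) l \<in> {l \<in> A_V i. \<forall>x\<in>set l. R x}"
    using * by cases (use l in \<open>auto simp: gap2_lists_def A_V_iff pos pos1\<close>)
  show "replicate (2 * i - length (filter ((<) 0) l)) 0 @ filter ((<) 0) l = l"
    using *
  proof cases
    case (2 m)
    then have "Suc (length m) = 2 * i"
      using l by (simp add: gap2_lists_def)
    then have "2 * i - length m = 1"
      by linarith
    then show ?thesis
      using 2 by (simp add: pos1)
  qed (use l in \<open>simp add: gap2_lists_def pos\<close>)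
  show "sum_list (filter ((<) 0) l) = sum_list l"
    using * by cases (simp_all add: pos pos1)
next
  fix l assume l: "l \<in> {l \<in> A_V i. \<forall>x\<in>set l. R x}"
  \<comment> \<open>At most one part is missing. For \<open>i = 0\<close> the second length
    condition of \<open>A_V\<close> cannot hold, so nothing is padded.\<close>
  then have "2 * i - length l = 0 \<or> 2 * i - length l = 1"
    by (auto simp: A_V_iff)
  then show "replicate (2 * i - length l) 0 @ l \<in> gap2_lists (2 * i) R"
    using l assms by (auto simp: A_V_iff gap2_lists_def sorted_wrt_append Suc_le_eq)
  show "filter ((<) 0) (replicate (2 * i - length l) 0 @ l) = l"
    using l by (auto simp: A_V_iff filter_replicate intro!: filter_True)
qed

text \<open>The head \<open>x\<close> is the first difference; each of the other \<open>k\<close>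
  entries is lowered by \<open>x\<close> and the minimal gap \<open>2\<close>. So \<open>x\<close>
  is counted \<open>Suc k\<close> times and \<open>2\<close> is counted \<open>k\<close> times. The
  hypothesis lets \<open>R\<close> pass through this shift.\<close>

lemma gap2_lists_Suc_weight_equiv:
  assumes "\<And>x y. R x \<Longrightarrow> R (x + y + 2) \<longleftrightarrow> R y"
  shows "weight_equiv ({x. R x} \<times> gap2_lists k R) (\<lambda>(x, l). Suc k * x + 2 * k + sum_list l)
    (gap2_lists (Suc k) R) sum_list"
proof (rule weight_equivI[of _ "\<lambda>(x, l). x # map (\<lambda>y. x + y + 2) l"
      _ "\<lambda>l. (hd l, map (\<lambda>y. y - hd l - 2) (tl l))"])
  fix l assume "l \<in> gap2_lists (Suc k) R"
  then obtain x m where l: "l = x # m" "x # m \<in> gap2_lists (Suc k) R"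
    by (cases l) (auto simp: gap2_lists_def)
  \<comment> \<open>Every entry of \<open>m\<close> is at least \<open>x + 2\<close>, so the
    truncated subtractions are exact, here and in the gap condition below.\<close>
  have inv: "map ((\<lambda>y. x + y + 2) \<circ> (\<lambda>y. y - x - 2)) m = m"
    using l by (intro map_idI) (auto simp: gap2_lists_def)
  then show "(case (hd l, map (\<lambda>y. y - hd l - 2) (tl l)) of (x, l) \<Rightarrow>
      x # map (\<lambda>y. x + y + 2) l) = l"
    by (simp add: l)
  have "R (y - x - 2)" if "y \<in> set m" for y
  proof -
    have "R x" "R y" "x + (y - x - 2) + 2 = y"
      using that l by (auto simp: gap2_lists_def)
    then show ?thesis
      using assms[of x "y - x - 2"] by argo
  qed
  moreover have "sorted_wrt (\<lambda>a b. a - x - 2 + 2 \<le> b - x - 2) m"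
    by (rule sorted_wrt_mono_rel[of _ "\<lambda>a b. a + 2 \<le> b"]) (use l in \<open>auto simp: gap2_lists_def\<close>)
  ultimately show "(hd l, map (\<lambda>y. y - hd l - 2) (tl l)) \<in> {x. R x} \<times> gap2_lists k R"
    using l by (auto simp: gap2_lists_def sorted_wrt_map)
next
  have sum: "sum_list (map (\<lambda>y. x + y + 2) l) = length l * x + 2 * length l + sum_list l"
    for x :: nat and l
    by (induction l) auto
  fix p assume "p \<in> {x. R x} \<times> gap2_lists k R"
  then obtain x l where p: "p = (x, l)" "R x" "l \<in> gap2_lists k R"
    by auto
  show "(case p of (x, l) \<Rightarrow> x # map (\<lambda>y. x + y + 2) l) \<in> gap2_lists (Suc k) R"
    using p assms by (auto simp: gap2_lists_def sorted_wrt_map)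
  show "sum_list (case p of (x, l) \<Rightarrow> x # map (\<lambda>y. x + y + 2) l) =
      (case p of (x, l) \<Rightarrow> Suc k * x + 2 * k + sum_list l)"
    using p by (simp only: prod.case sum_list.Cons sum) (auto simp: gap2_lists_def)
  show "(\<lambda>l. (hd l, map (\<lambda>y. y - hd l - 2) (tl l))) (case p of (x, l) \<Rightarrow>
      x # map (\<lambda>y. x + y + 2) l) = p"
    by (auto simp: p intro!: map_idI)
qed

text \<open>The Boolean tells whether the largest admissible part \<open>Suc k\<close> occurs; in an
  increasing list it can only stand last. This mirrors the recursion for gap lists, with one bit of
  weight \<open>Suc k\<close> per step.\<close>

lemma bounded_distinct_Suc_weight_equiv:
  "weight_equiv (UNIV \<times> bounded_distinct k) (\<lambda>(b, l). Suc k * of_bool b + sum_list l)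
    (bounded_distinct (Suc k)) sum_list"
proof (rule weight_equivI[of _ "\<lambda>(b, l). if b then l @ [Suc k] else l"
      _ "\<lambda>l. (Suc k \<in> set l, filter (\<lambda>x. x \<le> k) l)"])
  fix l assume l: "l \<in> bounded_distinct (Suc k)"
  then show "(Suc k \<in> set l, filter (\<lambda>x. x \<le> k) l) \<in> UNIV \<times> bounded_distinct k"
    by (auto simp: bounded_distinct_def D_all_iff sorted_wrt_filter)
  show "(case (Suc k \<in> set l, filter (\<lambda>x. x \<le> k) l) of (b, l) \<Rightarrow>
      if b then l @ [Suc k] else l) = l"
    using l
  proof (cases l rule: rev_cases)
    case (snoc m x)
    then show ?thesis
      using l by (auto simp: bounded_distinct_def D_all_iff sorted_wrt_append le_Suc_eq
          intro!: filter_True)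
  qed simp
qed (auto simp: bounded_distinct_def D_all_iff sorted_wrt_append le_Suc_eq less_Suc_eq_le
    intro: filter_True split: if_splits)

text \<open>Induction on the length. The head of a list of length \<open>Suc k\<close> is counted
  \<open>Suc k\<close> times, so rounding an odd head down loses weight \<open>Suc k\<close>, which
  a new part \<open>Suc k\<close> restores. The induction hypothesis rounds the remaining
  differences and yields parts at most \<open>k\<close>.\<close>

lemma gap2_lists_weight_equiv_even:
  "weight_equiv (gap2_lists k (\<lambda>_. True)) sum_list
    (gap2_lists k even \<times> bounded_distinct k) (\<lambda>(b, c). sum_list b + sum_list c)"
proof (induction k)
  case 0
  have "bounded_distinct 0 = {[]}"
    by (auto simp: bounded_distinct_def D_all_iff) (metis hd_in_set less_irrefl)
  then show ?case
    by (intro weight_equivI[of _ "\<lambda>l. (l, l)" _ fst]) (auto simp: gap2_lists_def)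
next
  case (Suc k)
  let ?E = "gap2_lists k even" and ?D = "bounded_distinct k"
  have "weight_equiv (gap2_lists (Suc k) (\<lambda>_. True)) sum_list
      (UNIV \<times> gap2_lists k (\<lambda>_. True)) (\<lambda>(x, l). (Suc k * x + 2 * k) + sum_list l)"
    (is "weight_equiv _ _ ?S1 ?w1")
    by (rule weight_equiv_sym) (use gap2_lists_Suc_weight_equiv[of "\<lambda>_. True" k] in simp)
  also have "weight_equiv ?S1 ?w1
      (UNIV \<times> (?E \<times> ?D)) (\<lambda>(x, p). (Suc k * x + 2 * k) + (case p of (b, c) \<Rightarrow> sum_list b + sum_list c))"
    (is "weight_equiv _ _ ?S2 ?w2")
    by (intro weight_equiv_Times weight_equiv_refl Suc.IH)
  \<comment> \<open>The parity of \<open>x\<close> becomes the bit that decides on the part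
    \<open>Suc k\<close>; the constant \<open>2 * k\<close> from the minimal gaps stays with the
    even list.\<close>
  also have "weight_equiv ?S2 ?w2 (({x. even x} \<times> ?E) \<times> (UNIV \<times> ?D))
      (\<lambda>(p, q). (case p of (x, b) \<Rightarrow> Suc k * x + 2 * k + sum_list b) +
        (case q of (r, c) \<Rightarrow> Suc k * of_bool r + sum_list c))"
    (is "weight_equiv _ _ ?S3 ?w3")
  proof (rule weight_equivI[of _ "\<lambda>(x, b, c). ((2 * (x div 2), b), (odd x, c))"
        _ "\<lambda>((x, b), (r, c)). (x + of_bool r, b, c)"])
    have x: "2 * (x div 2) + of_bool (odd x) = x" for x :: nat
      by (cases "even x") auto
    show "?w3 (case p of (x, b, c) \<Rightarrow> ((2 * (x div 2), b), (odd x, c))) = ?w2 p" for p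
    proof (cases p)
      case (fields x b c)
      have "Suc k * (2 * (x div 2)) + Suc k * of_bool (odd x) = Suc k * x"
        by (simp only: x flip: distrib_left)
      then show ?thesis
        by (simp only: fields prod.case)
    qed
  qed auto
  also have "weight_equiv ?S3 ?w3 (gap2_lists (Suc k) even \<times> bounded_distinct (Suc k))
      (\<lambda>(b, c). sum_list b + sum_list c)"
    by (intro weight_equiv_Times gap2_lists_Suc_weight_equiv bounded_distinct_Suc_weight_equiv) simp
  finally show ?case .
qed

text \<open>Cutting an increasing list at the value \<open>k\<close> undoes the appending. With
  \<open>k = 2 * i\<close> the second factor is \<open>B_V i\<close>.\<close>

lemma bounded_distinct_Times_weight_equiv:
  "weight_equiv (bounded_distinct k \<times> {l \<in> D_all. \<forall>x\<in>set l. k + 1 \<le> x})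
    (\<lambda>(l, m). sum_list l + sum_list m) D_all sum_list"
proof (rule weight_equivI[of _ "\<lambda>(l, m). l @ m"
      _ "\<lambda>l. (filter (\<lambda>x. x \<le> k) l, filter (\<lambda>x. \<not> x \<le> k) l)"])
  fix l assume "l \<in> D_all"
  then have "sorted_wrt (<) l"
    by (simp add: D_all_iff)
  then have "filter (\<lambda>x. x \<le> k) l @ filter (\<lambda>x. \<not> x \<le> k) l = l"
  proof (induction l)
    case (Cons a l)
    show ?case
    proof (cases "a \<le> k")
      \<comment> \<open>Once one entry exceeds \<open>k\<close>, all later ones do, so the first
        filter returns nothing.\<close>
      case False
      then have "\<forall>x\<in>set (a # l). \<not> x \<le> k"
        using Cons.prems by auto
      then show ?thesis
        by (simp only: filter_empty_conv[THEN iffD2] filter_id_conv[THEN iffD2] append_Nil not_not)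
    qed (use Cons in simp)
  qed simp
  then show "(case (filter (\<lambda>x. x \<le> k) l, filter (\<lambda>x. \<not> x \<le> k) l) of (l, m) \<Rightarrow> l @ m) = l"
    by simp
qed (fastforce simp: bounded_distinct_def D_all_iff sorted_wrt_append sorted_wrt_filter
    filter_empty_conv filter_id_conv)+

text \<open>Distinct even positive integers differ by at least \<open>2\<close> and exceed
  \<open>1\<close>, so each list in \<open>D_even\<close> lies in \<open>A_V i\<close> for exactly
  one \<open>i\<close>, half its length rounded up. Hence the index can be forgotten and
  recovered.\<close>

lemma even_A_V_weight_equiv_D_even:
  "weight_equiv (SIGMA i:UNIV. {l \<in> A_V i. \<forall>x\<in>set l. even x}) (\<lambda>(i, l). sum_list l)
    D_even sum_list"
proof (rule weight_equivI[of _ snd _ "\<lambda>l. ((length l + 1) div 2, l)"])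
  fix p assume "p \<in> (SIGMA i:UNIV. {l \<in> A_V i. \<forall>x\<in>set l. even x})"
  then obtain i l where p: "p = (i, l)" "l \<in> A_V i" "\<forall>x\<in>set l. even x"
    by auto
  then have "sorted_wrt (<) l"
    by (auto simp: A_V_iff intro: sorted_wrt_mono_rel[rotated])
  then show "snd p \<in> D_even"
    using p by (auto simp: D_even_def D_all_iff A_V_iff)
  show "((length (snd p) + 1) div 2, snd p) = p"
    using p by (auto simp: A_V_iff)
next
  fix l assume l: "l \<in> D_even"
  have "x + 2 \<le> y" if "x < y" "even x" "even y" for x y :: nat
    using that by presburger
  then have "sorted_wrt (\<lambda>x y. x + 2 \<le> y) l"
    using l by (auto simp: D_even_def D_all_iff intro: sorted_wrt_mono_rel[rotated])
  moreover have "length l = 2 * ((length l + 1) div 2) \<or> length l + 1 = 2 * ((length l + 1) div 2)"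
    by presburger
  moreover have "1 < x" if "x \<in> set l" for x
    using l that by (auto simp: D_even_def D_all_iff intro!: Suc_lessI)
  ultimately show "((length l + 1) div 2, l) \<in> (SIGMA i:UNIV. {l \<in> A_V i. \<forall>x\<in>set l. even x})"
    using l by (auto simp: A_V_iff D_even_def D_all_iff)
qed auto

text \<open>For fixed \<open>i\<close>, the even gap list is turned back into a member of
  \<open>A_V i\<close>, while the parts at most \<open>2 * i\<close> that record odd differences
  merge with \<open>B_V i\<close> into an arbitrary member of \<open>D_all\<close>.\<close>

lemma A_V_Times_B_V_weight_equiv:
  "weight_equiv (A_V i \<times> B_V i) (\<lambda>(l, m). sum_list l + sum_list m)
    ({l \<in> A_V i. \<forall>x\<in>set l. even x} \<times> D_all) (\<lambda>(b, c). sum_list b + sum_list c)"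
proof -
  let ?E = "gap2_lists (2 * i) even" and ?D = "bounded_distinct (2 * i)"
  have "weight_equiv (A_V i) sum_list (gap2_lists (2 * i) (\<lambda>_. True)) sum_list"
    by (rule weight_equiv_sym) (use gap2_lists_weight_equiv_A_V[of "\<lambda>_. True" i] in simp)
  also note gap2_lists_weight_equiv_even
  finally have "weight_equiv (A_V i \<times> B_V i) (\<lambda>(l, m). sum_list l + sum_list m)
      ((?E \<times> ?D) \<times> B_V i) (\<lambda>(p, m). (case p of (b, c) \<Rightarrow> sum_list b + sum_list c) + sum_list m)"
    (is "weight_equiv _ _ ?S4 ?w4")
    by (intro weight_equiv_Times weight_equiv_refl)
  also have "weight_equiv ?S4 ?w4 (?E \<times> (?D \<times> B_V i))
      (\<lambda>(b, p). sum_list b + (case p of (c, m) \<Rightarrow> sum_list c + sum_list m))"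
    (is "weight_equiv _ _ ?S5 ?w5")
    by (rule weight_equivI[of _ "\<lambda>((b, c), m). (b, (c, m))" _ "\<lambda>(b, (c, m)). ((b, c), m)"]) auto
  also have "weight_equiv ?S5 ?w5 ({l \<in> A_V i. \<forall>x\<in>set l. even x} \<times> D_all)
      (\<lambda>(b, c). sum_list b + sum_list c)"
    unfolding B_V_def
    by (intro weight_equiv_Times gap2_lists_weight_equiv_A_V bounded_distinct_Times_weight_equiv) simp
  finally show ?thesis .
qed

theorem theorem3p2:
  shows "\<exists>\<theta>\<^sub>2 :: nat \<times> nat list \<times> nat list \<Rightarrow> nat list \<times> nat list.
    bij_betw \<theta>\<^sub>2 (SIGMA i:UNIV. A_V i \<times> B_V i) (D_even \<times> D_all) \<and>
    (\<forall>i. \<forall>l\<in>A_V i. \<forall>m\<in>B_V i. \<forall>\<beta> \<gamma>. \<theta>\<^sub>2 (i, l, m) = (\<beta>, \<gamma>) \<longrightarrow>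
       sum_list l + sum_list m = sum_list \<beta> + sum_list \<gamma>)"
proof -
  let ?E = "\<lambda>i. {l \<in> A_V i. \<forall>x\<in>set l. even x}"
  have "weight_equiv (SIGMA i:UNIV. A_V i \<times> B_V i)
      (\<lambda>(i, p). case p of (l, m) \<Rightarrow> sum_list l + sum_list m)
      (SIGMA i:UNIV. ?E i \<times> D_all) (\<lambda>(i, p). case p of (b, c) \<Rightarrow> sum_list b + sum_list c)"
    (is "weight_equiv _ _ ?S6 ?w6")
    by (intro weight_equiv_Sigma A_V_Times_B_V_weight_equiv)
  \<comment> \<open>\<open>D_all\<close> does not depend on \<open>i\<close>, so it comes out of the
    disjoint union; the union of the even lists that remains is then matched with
    \<open>D_even\<close>.\<close>
  also have "weight_equiv ?S6 ?w6 ((SIGMA i:UNIV. ?E i) \<times> D_all)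
      (\<lambda>(p, c). (case p of (i, b) \<Rightarrow> sum_list b) + sum_list c)"
    (is "weight_equiv _ _ ?S7 ?w7")
    by (rule weight_equivI[of _ "\<lambda>(i, b, c). ((i, b), c)" _ "\<lambda>((i, b), c). (i, b, c)"]) auto
  also have "weight_equiv ?S7 ?w7 (D_even \<times> D_all) (\<lambda>(b, c). sum_list b + sum_list c)"
    by (intro weight_equiv_Times weight_equiv_refl even_A_V_weight_equiv_D_even)
  finally obtain f where f: "bij_betw f (SIGMA i:UNIV. A_V i \<times> B_V i) (D_even \<times> D_all)"
    "\<forall>x\<in>(SIGMA i:UNIV. A_V i \<times> B_V i). (case f x of (b, c) \<Rightarrow> sum_list b + sum_list c) =
      (case x of (i, l, m) \<Rightarrow> sum_list l + sum_list m)"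
    unfolding weight_equiv_def by blast
  then show ?thesis
    by (intro exI[of _ f]) fastforce
qed

end
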